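(* Let $n\ge1$, let $H_1,\dots,H_n$ be infinite-dimensional separable complex Hilbert spaces, and let $A_j\in\mathcal{B}(H_j)$ be absolutely minimum attaining for $j=1,\dots,n$. Then $\bigoplus_{j=1}^nA_j\in\mathcal{M}_r\left(\bigoplus_{j=1}^nH_j\right)$.
   Context: $\mathcal{B}(H)$ denotes the bounded linear operators on $H$. For a nonzero Hilbert space $M$, a Hilbert space $L$ and a bounded linear operator $A:M\to L$, the minimum modulus is $m(A)=\inf\{\|Ax\|: x\in M,\ \|x\|=1\}$; $A$ is minimum attaining if there is a unit vector $x_0\in M$ with $\|Ax_0\|=m(A)$. An operator $A\in\mathcal{B}(H)$ is absolutely minimum attaining if for every nonzero closed subspace $M\subseteq H$ the restriction $A|_M:M\to H$ is minimum attaining. A closed subspace $M\subseteq H$ reduces $T\in\mathcal{B}(H)$ if $T(M)\subseteq M$ and $T^*(M)\subseteq M$. $\mathcal{M}_r(H)$ is the set of all $T\in\mathcal{B}(H)$ such that for every nonzero closed subspace $M$ reducing $T$, the restriction $T|_M:M\to M$ is minimum attaining. $\bigoplus_jH_j$ is the Hilbert space direct sum and $\left(\bigoplus_jA_j\right)(x_1,\dots,x_n)=(A_1x_1,\dots,A_nx_n)$. *)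

theory Defs
  imports "Jordan_Normal_Form.VS_Connect" "HOL-Analysis.Analysis"
begin

text \<open>
  Hilbert spaces are carrier-based structures extending the \<open>module\<close> records, so that a family
  indexed by a natural number may consist of different spaces. As for every \<open>module\<close> record, the
  fields \<open>mult\<close> and \<open>one\<close> play no role.
\<close>

record 'a inner_product_space = "(complex, 'a) module" +
  cinner :: "'a \<Rightarrow> 'a \<Rightarrow> complex"

definition hnorm :: "('a, 'r) inner_product_space_scheme \<Rightarrow> 'a \<Rightarrow> real" where
  "hnorm H x = sqrt (Re (cinner H x x))"

text \<open>
  \<^locale>\<open>Metric_space\<close> requires its distance to be nonnegative and symmetric on the whole type,
  hence the value 0 off the carrier.
\<close>

definition hdist :: "('a, 'r) inner_product_space_scheme \<Rightarrow> 'a \<Rightarrow> 'a \<Rightarrow> real" where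
  "hdist H x y =
    (if x \<in> carrier H \<and> y \<in> carrier H then hnorm H (x \<ominus>\<^bsub>H\<^esub> y) else 0)"

definition htopology :: "('a, 'r) inner_product_space_scheme \<Rightarrow> 'a topology" where
  "htopology H = Metric_space.mtopology (carrier H) (hdist H)"

locale complex_hilbert_space = vectorspace "class_ring :: complex ring" H
  for H :: "('a, 'r) inner_product_space_scheme" (structure) +
  assumes cinner_commute:
      "\<lbrakk>x \<in> carrier H; y \<in> carrier H\<rbrakk> \<Longrightarrow> cinner H x y = cnj (cinner H y x)"
    and cinner_add_left:
      "\<lbrakk>x \<in> carrier H; y \<in> carrier H; z \<in> carrier H\<rbrakk>
        \<Longrightarrow> cinner H (x \<oplus> y) z = cinner H x z + cinner H y z"
    and cinner_smult_left:
      "\<lbrakk>x \<in> carrier H; y \<in> carrier H\<rbrakk> \<Longrightarrow> cinner H (c \<odot>\<^bsub>H\<^esub> x) y = c * cinner H x y"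
    and cinner_pos:
      "\<lbrakk>x \<in> carrier H; x \<noteq> \<zero>\<rbrakk> \<Longrightarrow> 0 < Re (cinner H x x)"
    and complete: "Metric_space.mcomplete (carrier H) (hdist H)"

definition separable_hilbert_space :: "('a, 'r) inner_product_space_scheme \<Rightarrow> bool" where
  "separable_hilbert_space H \<longleftrightarrow> complex_hilbert_space H \<and> separable_space (htopology H)"

definition infinite_dimensional :: "('a, 'r) inner_product_space_scheme \<Rightarrow> bool" where
  "infinite_dimensional H \<longleftrightarrow> \<not> vectorspace.fin_dim (class_ring :: complex ring) H"

definition closed_subspace ::
  "'a set \<Rightarrow> ('a, 'r) inner_product_space_scheme \<Rightarrow> bool" where
  "closed_subspace M H \<longleftrightarrow>
    VectorSpace.subspace (class_ring :: complex ring) M H \<and> closedin (htopology H) M"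

text \<open>Operators are functions on the underlying types; only their values on the carrier matter.\<close>

definition bounded_operators ::
  "('a, 'r) inner_product_space_scheme \<Rightarrow> ('b, 's) inner_product_space_scheme \<Rightarrow> ('a \<Rightarrow> 'b) set" where
  "bounded_operators H K =
    {A \<in> LinearCombinations.module_hom (class_ring :: complex ring) H K.
      \<exists>C. \<forall>x\<in>carrier H. hnorm K (A x) \<le> C * hnorm H x}"

text \<open>\<open>hadjoint H T\<close> sends \<open>y\<close> to the Riesz representative of \<open>x \<mapsto> \<langle>T x, y\<rangle>\<close>.\<close>

definition hadjoint :: "('a, 'r) inner_product_space_scheme \<Rightarrow> ('a \<Rightarrow> 'a) \<Rightarrow> 'a \<Rightarrow> 'a" where
  "hadjoint H T y =
    (THE z. z \<in> carrier H \<and> (\<forall>x\<in>carrier H. cinner H (T x) y = cinner H x z))"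

definition min_modulus ::
  "('a, 'r) inner_product_space_scheme \<Rightarrow> ('b, 's) inner_product_space_scheme \<Rightarrow> ('a \<Rightarrow> 'b) \<Rightarrow> real" where
  "min_modulus M L A = Inf {hnorm L (A x) | x. x \<in> carrier M \<and> hnorm M x = 1}"

definition min_attaining ::
  "('a, 'r) inner_product_space_scheme \<Rightarrow> ('b, 's) inner_product_space_scheme \<Rightarrow> ('a \<Rightarrow> 'b) \<Rightarrow> bool" where
  "min_attaining M L A \<longleftrightarrow>
    (\<exists>x\<^sub>0\<in>carrier M. hnorm M x\<^sub>0 = 1 \<and> hnorm L (A x\<^sub>0) = min_modulus M L A)"

definition abs_min_attaining ::
  "('a, 'r) inner_product_space_scheme \<Rightarrow> ('a \<Rightarrow> 'a) \<Rightarrow> bool" where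
  "abs_min_attaining H A \<longleftrightarrow>
    A \<in> bounded_operators H H \<and>
    (\<forall>M. closed_subspace M H \<and> M \<noteq> {\<zero>\<^bsub>H\<^esub>} \<longrightarrow> min_attaining (H\<lparr>carrier := M\<rparr>) H A)"

definition reduces ::
  "('a, 'r) inner_product_space_scheme \<Rightarrow> 'a set \<Rightarrow> ('a \<Rightarrow> 'a) \<Rightarrow> bool" where
  "reduces H M T \<longleftrightarrow> closed_subspace M H \<and> T ` M \<subseteq> M \<and> hadjoint H T ` M \<subseteq> M"

definition min_attaining_on_reducing ::
  "('a, 'r) inner_product_space_scheme \<Rightarrow> ('a \<Rightarrow> 'a) set"  (\<open>\<M>\<^sub>r\<close>) where
  "\<M>\<^sub>r H =
    {T \<in> bounded_operators H H.
      \<forall>M. reduces H M T \<and> M \<noteq> {\<zero>\<^bsub>H\<^esub>} \<longrightarrow>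
        min_attaining (H\<lparr>carrier := M\<rparr>) (H\<lparr>carrier := M\<rparr>) T}"

text \<open>Tuples are extensional functions on the index set, which is meant to be finite.\<close>

definition hilbert_sum ::
  "'i set \<Rightarrow> ('i \<Rightarrow> ('a, 'r) inner_product_space_scheme) \<Rightarrow> ('i \<Rightarrow> 'a) inner_product_space" where
  "hilbert_sum I H =
    \<lparr>carrier = (\<Pi>\<^sub>E j\<in>I. carrier (H j)),
     monoid.mult = (\<lambda>x y. undefined),
     one = undefined,
     zero = (\<lambda>j\<in>I. \<zero>\<^bsub>H j\<^esub>),
     add = (\<lambda>x y. \<lambda>j\<in>I. x j \<oplus>\<^bsub>H j\<^esub> y j),
     module.smult = (\<lambda>c x. \<lambda>j\<in>I. c \<odot>\<^bsub>H j\<^esub> x j),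
     cinner = (\<lambda>x y. \<Sum>j\<in>I. cinner (H j) (x j) (y j))\<rparr>"

definition operator_sum :: "'i set \<Rightarrow> ('i \<Rightarrow> 'a \<Rightarrow> 'a) \<Rightarrow> ('i \<Rightarrow> 'a) \<Rightarrow> 'i \<Rightarrow> 'a" where
  "operator_sum I A x = (\<lambda>j\<in>I. A j (x j))"

end

theory Submission
  imports Defs
begin

text \<open>
  Let \<open>M\<close> reduce \<open>T = \<Oplus>\<^sub>j A\<^sub>j\<close>, let \<open>\<mu>\<close> be the minimum modulus of \<open>T\<close> on \<open>M\<close>, and suppose that \<open>\<mu>\<close> is
  not attained. Projecting an eigenvector of \<open>T\<^sup>*T\<close> with eigenvalue at most \<open>\<mu>\<^sup>2\<close> to \<open>M\<close> gives an
  eigenvector in \<open>M\<close> for the same eigenvalue, which must be zero; so \<open>M\<close> is orthogonal to all such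
  eigenvectors, in particular to those of the summands. In \<open>H\<^sub>j\<close>, let \<open>N\<^sub>j\<close> be the orthogonal
  complement of the eigenvectors of \<open>A\<^sub>j\<^sup>*A\<^sub>j\<close> with eigenvalue at most \<open>\<mu>\<^sup>2\<close>. It is closed and
  invariant under \<open>A\<^sub>j\<^sup>*A\<^sub>j\<close>, so a unit vector of \<open>N\<^sub>j\<close> at which \<open>A\<^sub>j\<close> attains its minimum is an
  eigenvector, with eigenvalue exceeding \<open>\<mu>\<^sup>2\<close>. Hence \<open>T\<close> is bounded below on \<open>M\<close> by a constant
  larger than \<open>\<mu>\<close>, a contradiction.
\<close>

section \<open>Inner product spaces on a carrier\<close>

text \<open>Completeness is split off so that all facts on the inner product are available for
  direct sums and for subspaces before these are known to be complete.\<close>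

locale pre_hilbert_space = vectorspace "class_ring :: complex ring" H
  for H :: "('a, 'r) inner_product_space_scheme" (structure) +
  assumes cinner_commute:
      "\<lbrakk>x \<in> carrier H; y \<in> carrier H\<rbrakk> \<Longrightarrow> cinner H x y = cnj (cinner H y x)"
    and cinner_add_left:
      "\<lbrakk>x \<in> carrier H; y \<in> carrier H; z \<in> carrier H\<rbrakk>
        \<Longrightarrow> cinner H (x \<oplus> y) z = cinner H x z + cinner H y z"
    and cinner_smult_left:
      "\<lbrakk>x \<in> carrier H; y \<in> carrier H\<rbrakk> \<Longrightarrow> cinner H (c \<odot>\<^bsub>H\<^esub> x) y = c * cinner H x y"
    and cinner_pos:
      "\<lbrakk>x \<in> carrier H; x \<noteq> \<zero>\<rbrakk> \<Longrightarrow> 0 < Re (cinner H x x)"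

sublocale complex_hilbert_space \<subseteq> pre_hilbert_space
  by unfold_locales (fact cinner_commute cinner_add_left cinner_smult_left cinner_pos)+

section \<open>Sesquilinear algebra, the norm, Cauchy-Schwarz and the triangle inequality\<close>

context pre_hilbert_space
begin

text \<open>Every complex number is a scalar of \<open>class_ring\<close>, so no side condition on
  \<open>c\<close> remains.\<close>

lemma smult_in_carrier [simp, intro]: "x \<in> carrier H \<Longrightarrow> c \<odot>\<^bsub>H\<^esub> x \<in> carrier H"
  by simp

lemma cinner_zero_left [simp]: "x \<in> carrier H \<Longrightarrow> cinner H \<zero> x = 0"
  using cinner_add_left [of \<zero> \<zero> x] by simp

lemma cinner_minus_left:
  assumes "x \<in> carrier H" "y \<in> carrier H" "z \<in> carrier H"
  shows "cinner H (x \<ominus> y) z = cinner H x z - cinner H y z"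
proof -
  have "(x \<ominus> y) \<oplus> y = x"
    using assms by (simp add: a_minus_def a_assoc l_neg)
  then have "cinner H x z = cinner H (x \<ominus> y) z + cinner H y z"
    using cinner_add_left [of "x \<ominus> y" y z] assms by simp
  then show ?thesis by simp
qed

lemma cinner_zero_right [simp]: "x \<in> carrier H \<Longrightarrow> cinner H x \<zero> = 0"
  by (subst cinner_commute) simp_all

lemma cinner_add_right:
  assumes "x \<in> carrier H" "y \<in> carrier H" "z \<in> carrier H"
  shows "cinner H x (y \<oplus> z) = cinner H x y + cinner H x z"
  using assms cinner_commute [of x "y \<oplus> z"] cinner_commute [of x y] cinner_commute [of x z]
  by (simp add: cinner_add_left)

lemma cinner_smult_right:
  assumes "x \<in> carrier H" "y \<in> carrier H"
  shows "cinner H x (c \<odot>\<^bsub>H\<^esub> y) = cnj c * cinner H x y"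
  using assms cinner_commute [of x "c \<odot>\<^bsub>H\<^esub> y"] cinner_commute [of x y]
  by (simp add: cinner_smult_left)

lemma cinner_minus_right:
  assumes "x \<in> carrier H" "y \<in> carrier H" "z \<in> carrier H"
  shows "cinner H x (y \<ominus> z) = cinner H x y - cinner H x z"
  using assms cinner_commute [of x "y \<ominus> z"] cinner_commute [of x y] cinner_commute [of x z]
  by (simp add: cinner_minus_left)

lemmas cinner_simps = cinner_add_left cinner_add_right cinner_minus_left cinner_minus_right
  cinner_smult_left cinner_smult_right

lemma Re_cinner_self_nonneg: "x \<in> carrier H \<Longrightarrow> 0 \<le> Re (cinner H x x)"
  using cinner_pos [of x] by (cases "x = \<zero>") auto

lemma hnorm_nonneg [simp]: "x \<in> carrier H \<Longrightarrow> 0 \<le> hnorm H x"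
  by (simp add: hnorm_def Re_cinner_self_nonneg)

lemma hnorm_sq: "x \<in> carrier H \<Longrightarrow> (hnorm H x)\<^sup>2 = Re (cinner H x x)"
  by (simp add: hnorm_def Re_cinner_self_nonneg)

lemma cinner_self: "x \<in> carrier H \<Longrightarrow> cinner H x x = of_real ((hnorm H x)\<^sup>2)"
  using arg_cong [OF cinner_commute [of x x], of Im] by (simp add: hnorm_sq complex_eq_iff)

lemma hnorm_zero [simp]: "hnorm H \<zero> = 0"
  by (simp add: hnorm_def)

lemma hnorm_eq_0_iff: "x \<in> carrier H \<Longrightarrow> hnorm H x = 0 \<longleftrightarrow> x = \<zero>"
  using cinner_pos [of x] by (cases "x = \<zero>") (auto simp: hnorm_def)

lemma hnorm_pos: "x \<in> carrier H \<Longrightarrow> x \<noteq> \<zero> \<Longrightarrow> 0 < hnorm H x"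
  using cinner_pos [of x] by (auto simp: hnorm_def)

lemma hnorm_smult: "x \<in> carrier H \<Longrightarrow> hnorm H (c \<odot>\<^bsub>H\<^esub> x) = cmod c * hnorm H x"
proof -
  assume x: "x \<in> carrier H"
  have "(hnorm H (c \<odot>\<^bsub>H\<^esub> x))\<^sup>2 = Re (c * cnj c * cinner H x x)"
    using x by (simp add: hnorm_sq cinner_simps) (simp add: algebra_simps)
  also have "\<dots> = (cmod c * hnorm H x)\<^sup>2"
    using x by (simp add: cinner_self complex_norm_square [symmetric] power_mult_distrib
        flip: of_real_power of_real_mult)
  finally have "(hnorm H (c \<odot>\<^bsub>H\<^esub> x))\<^sup>2 = (cmod c * hnorm H x)\<^sup>2" .
  then show ?thesis
    using x by (simp add: power2_eq_iff_nonneg)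
qed

text \<open>A real quadratic polynomial in \<open>t\<close>: it drives Cauchy-Schwarz and the two
  later first-variation arguments, for the Riesz minimizer and for the minimum of \<open>A\<close>
  on a subspace.\<close>

lemma hnorm_add_smult_sq:
  assumes "x \<in> carrier H" "y \<in> carrier H"
  shows "(hnorm H (x \<oplus> of_real t \<odot>\<^bsub>H\<^esub> y))\<^sup>2 =
    (hnorm H x)\<^sup>2 + 2 * t * Re (cinner H x y) + t\<^sup>2 * (hnorm H y)\<^sup>2"
  using assms cinner_commute [of y x]
  by (simp add: hnorm_sq cinner_simps) (simp add: algebra_simps power2_eq_square)

lemma hnorm_minus_sq:
  assumes "x \<in> carrier H" "y \<in> carrier H"
  shows "(hnorm H (x \<ominus> y))\<^sup>2 = (hnorm H x)\<^sup>2 - 2 * Re (cinner H x y) + (hnorm H y)\<^sup>2"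
  using assms cinner_commute [of y x] by (simp add: hnorm_sq cinner_simps)

lemma hnorm_add_sq:
  assumes "x \<in> carrier H" "y \<in> carrier H"
  shows "(hnorm H (x \<oplus> y))\<^sup>2 = (hnorm H x)\<^sup>2 + 2 * Re (cinner H x y) + (hnorm H y)\<^sup>2"
  using assms cinner_commute [of y x] by (simp add: hnorm_sq cinner_simps)

lemma Re_cinner_le:
  assumes x: "x \<in> carrier H" and y: "y \<in> carrier H"
  shows "Re (cinner H x y) \<le> hnorm H x * hnorm H y"
proof (cases "y = \<zero>")
  case False
  then have b: "hnorm H y > 0" using y hnorm_pos by blast
  \<comment> \<open>\<open>?t\<close> minimizes the quadratic ||x + t y||^2 over real t; its value
    there is the Cauchy-Schwarz defect.\<close>
  let ?c = "Re (cinner H x y)" and ?t = "- Re (cinner H x y) / (hnorm H y)\<^sup>2"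
  have "0 \<le> (hnorm H x)\<^sup>2 + 2 * ?t * ?c + ?t\<^sup>2 * (hnorm H y)\<^sup>2"
    unfolding hnorm_add_smult_sq [OF x y, of ?t, symmetric] by simp
  also have "\<dots> = (hnorm H x)\<^sup>2 - ?c\<^sup>2 / (hnorm H y)\<^sup>2"
    using b by (simp add: field_simps power2_eq_square)
  finally have "?c\<^sup>2 \<le> (hnorm H x * hnorm H y)\<^sup>2"
    using b by (simp add: field_simps power_mult_distrib)
  then show ?thesis
    by (rule power2_le_imp_le) (use x y in simp)
qed (use x in simp)

lemma norm_cinner_le:
  assumes x: "x \<in> carrier H" and y: "y \<in> carrier H"
  shows "cmod (cinner H x y) \<le> hnorm H x * hnorm H y"
proof (cases "cinner H x y = 0")
  case False
  \<comment> \<open>A phase of modulus one that rotates the inner product onto the nonnegative real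
    axis, where the bound for real parts applies.\<close>
  define u where "u = cnj (cinner H x y) / of_real (cmod (cinner H x y))"
  have u: "cmod u = 1" using False by (simp add: u_def norm_divide)
  have "u * cinner H x y = of_real (cmod (cinner H x y))"
    using False complex_norm_square [of "cinner H x y"]
    by (simp add: u_def power2_eq_square field_simps)
  then have "cmod (cinner H x y) = Re (cinner H (u \<odot>\<^bsub>H\<^esub> x) y)"
    using x y by (simp add: cinner_smult_left)
  also have "\<dots> \<le> hnorm H (u \<odot>\<^bsub>H\<^esub> x) * hnorm H y"
    using x y by (intro Re_cinner_le) auto
  finally show ?thesis using u x by (simp add: hnorm_smult)
qed (use x y in simp)

lemma hnorm_triangle:
  assumes x: "x \<in> carrier H" and y: "y \<in> carrier H"
  shows "hnorm H (x \<oplus> y) \<le> hnorm H x + hnorm H y"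
proof (rule power2_le_imp_le)
  show "(hnorm H (x \<oplus> y))\<^sup>2 \<le> (hnorm H x + hnorm H y)\<^sup>2"
    using Re_cinner_le [OF x y] x y
    by (simp add: hnorm_add_sq power2_sum algebra_simps)
qed (use x y in simp)

lemma hnorm_minus_commute:
  assumes "x \<in> carrier H" "y \<in> carrier H"
  shows "hnorm H (x \<ominus> y) = hnorm H (y \<ominus> x)"
proof (rule power2_eq_imp_eq)
  show "(hnorm H (x \<ominus> y))\<^sup>2 = (hnorm H (y \<ominus> x))\<^sup>2"
    using assms cinner_commute [of x y] by (simp only: hnorm_minus_sq) simp
qed (use assms in simp_all)

section \<open>Metric, closedness and completeness in terms of norm convergence\<close>

lemma Metric_space_hdist: "Metric_space (carrier H) (hdist H)"
proof
  fix x y z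
  show "0 \<le> hdist H x y" by (simp add: hdist_def)
  show "hdist H x y = hdist H y x" by (simp add: hdist_def hnorm_minus_commute)
  assume x: "x \<in> carrier H" and y: "y \<in> carrier H"
  then show "(hdist H x y = 0) = (x = y)"
    by (simp add: hdist_def hnorm_eq_0_iff)
  assume z: "z \<in> carrier H"
  have "x \<ominus> z = (x \<ominus> y) \<oplus> (y \<ominus> z)"
    using x y z by (simp add: a_minus_def a_assoc r_neg1)
  then show "hdist H x z \<le> hdist H x y + hdist H y z"
    using x y z hnorm_triangle [of "x \<ominus> y" "y \<ominus> z"] by (simp add: hdist_def)
qed

sublocale hmetric: Metric_space "carrier H" "hdist H"
  by (fact Metric_space_hdist)

lemma limitin_htopology:
  "limitin (htopology H) \<sigma> l sequentially \<longleftrightarrow>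
    l \<in> carrier H \<and> eventually (\<lambda>n. \<sigma> n \<in> carrier H) sequentially \<and>
    (\<lambda>n. hnorm H (\<sigma> n \<ominus> l)) \<longlonglongrightarrow> 0"
proof -
  \<comment> \<open>Off the carrier \<open>hdist\<close> has the default value 0, so the two
    sequences are known to agree only eventually.\<close>
  have "((\<lambda>n. hdist H (\<sigma> n) l) \<longlonglongrightarrow> 0) = ((\<lambda>n. hnorm H (\<sigma> n \<ominus> l)) \<longlonglongrightarrow> 0)"
    if "l \<in> carrier H" "eventually (\<lambda>n. \<sigma> n \<in> carrier H) sequentially"
    using eventually_mono [OF that(2)]
    by (rule tendsto_cong) (simp add: hdist_def that(1))
  then show ?thesis
    by (auto simp: htopology_def hmetric.limitin_metric_dist_null)
qed

text \<open>Closed sets of a metric space are the sequentially closed ones; for a sequence inside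
  the carrier, convergence is just that of norms.\<close>

lemma closedin_htopology:
  "closedin (htopology H) S \<longleftrightarrow> S \<subseteq> carrier H \<and>
    (\<forall>\<sigma> l. range \<sigma> \<subseteq> S \<and> l \<in> carrier H \<and> (\<lambda>n. hnorm H (\<sigma> n \<ominus> l)) \<longlonglongrightarrow> 0 \<longrightarrow> l \<in> S)"
proof -
  have "limitin (htopology H) \<sigma> l sequentially \<longleftrightarrow>
      l \<in> carrier H \<and> (\<lambda>n. hnorm H (\<sigma> n \<ominus> l)) \<longlonglongrightarrow> 0"
    if "S \<subseteq> carrier H" "range \<sigma> \<subseteq> S" for \<sigma> l
    using that unfolding limitin_htopology by (auto intro!: always_eventually)
  then show ?thesis
    unfolding htopology_def hmetric.metric_closedin_iff_sequentially_closed by blast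
qed

lemma MCauchy_hdist:
  "hmetric.MCauchy \<sigma> \<longleftrightarrow> range \<sigma> \<subseteq> carrier H \<and>
    (\<forall>\<epsilon>>0. \<exists>N. \<forall>n n'. N \<le> n \<longrightarrow> N \<le> n' \<longrightarrow> hnorm H (\<sigma> n \<ominus> \<sigma> n') < \<epsilon>)"
  by (auto simp: hmetric.MCauchy_def hdist_def image_subset_iff)

lemma mcomplete_hdist:
  "hmetric.mcomplete \<longleftrightarrow>
    (\<forall>\<sigma>. hmetric.MCauchy \<sigma> \<longrightarrow>
      (\<exists>l\<in>carrier H. (\<lambda>n. hnorm H (\<sigma> n \<ominus> l)) \<longlonglongrightarrow> 0))"
proof -
  have "limitin hmetric.mtopology \<sigma> l sequentially \<longleftrightarrow>
      l \<in> carrier H \<and> (\<lambda>n. hnorm H (\<sigma> n \<ominus> l)) \<longlonglongrightarrow> 0"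
    if "hmetric.MCauchy \<sigma>" for \<sigma> l
    using that limitin_htopology [of \<sigma> l, unfolded htopology_def]
    by (auto intro!: always_eventually simp: MCauchy_hdist image_subset_iff)
  then show ?thesis
    unfolding hmetric.mcomplete_def by blast
qed

text \<open>Cauchy-Schwarz bounds the difference of the inner products. This continuity is what
  makes orthogonal complements closed.\<close>

lemma tendsto_cinner:
  assumes "range \<sigma> \<subseteq> carrier H" "l \<in> carrier H" "x \<in> carrier H"
    and "(\<lambda>n. hnorm H (\<sigma> n \<ominus> l)) \<longlonglongrightarrow> 0"
  shows "(\<lambda>n. cinner H (\<sigma> n) x) \<longlonglongrightarrow> cinner H l x"
proof -
  have "(\<lambda>n. hnorm H (\<sigma> n \<ominus> l) * hnorm H x) \<longlonglongrightarrow> 0"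
    using assms(4) by (rule tendsto_mult_left_zero)
  then have "(\<lambda>n. cinner H (\<sigma> n) x - cinner H l x) \<longlonglongrightarrow> 0"
  proof (rule Lim_null_comparison [rotated], intro always_eventually allI)
    fix n
    have "\<sigma> n \<in> carrier H" using assms(1) by auto
    then show "norm (cinner H (\<sigma> n) x - cinner H l x) \<le> hnorm H (\<sigma> n \<ominus> l) * hnorm H x"
      using norm_cinner_le [of "\<sigma> n \<ominus> l" x] assms(2,3) by (simp add: cinner_minus_left)
  qed
  then show ?thesis by (simp add: LIM_zero_iff)
qed

end

text \<open>For small t of suitable sign the linear term would dominate the quadratic one. This
  serves as the first-order condition at a minimum.\<close>

lemma linear_term_eq_0:
  fixes c d :: real
  assumes "\<And>t. 0 \<le> 2 * t * c + t\<^sup>2 * d"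
  shows "c = 0"
proof (rule ccontr)
  assume c: "c \<noteq> 0"
  \<comment> \<open>\<open>D\<close> is positive and exceeds \<open>d\<close> whatever the sign of
    \<open>d\<close>, so \<open>d - 2 * D\<close> is negative and t = -c/D violates the
    hypothesis.\<close>
  define D where "D = \<bar>d\<bar> + 1"
  have D: "0 < D" "d < D" by (auto simp: D_def)
  have "0 \<le> 2 * (- c / D) * c + (- c / D)\<^sup>2 * d" by (fact assms)
  also have "\<dots> = (c / D)\<^sup>2 * (d - 2 * D)"
    using D by (simp add: field_simps power2_eq_square)
  also have "\<dots> < 0"
    using c D by (intro mult_pos_neg) auto
  finally show False by simp
qed

section \<open>Bounded operators\<close>

lemma bounded_operators_in_carrier:
  "A \<in> bounded_operators H K \<Longrightarrow> x \<in> carrier H \<Longrightarrow> A x \<in> carrier K"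
  by (auto simp: bounded_operators_def LinearCombinations.module_hom_def)

lemma bounded_operators_add:
  "A \<in> bounded_operators H K \<Longrightarrow> x \<in> carrier H \<Longrightarrow> y \<in> carrier H
    \<Longrightarrow> A (x \<oplus>\<^bsub>H\<^esub> y) = A x \<oplus>\<^bsub>K\<^esub> A y"
  by (auto simp: bounded_operators_def LinearCombinations.module_hom_def)

lemma bounded_operators_smult:
  "A \<in> bounded_operators H K \<Longrightarrow> x \<in> carrier H \<Longrightarrow> A (c \<odot>\<^bsub>H\<^esub> x) = c \<odot>\<^bsub>K\<^esub> A x"
  by (auto simp: bounded_operators_def LinearCombinations.module_hom_def)

lemma hnorm_carrier_update [simp]: "hnorm (H\<lparr>carrier := M\<rparr>) x = hnorm H x"
  by (simp add: hnorm_def)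

context pre_hilbert_space
begin

lemma bounded_operators_bound:
  fixes K :: "('b, 's) inner_product_space_scheme"
  assumes "A \<in> bounded_operators H K"
  obtains C where "0 \<le> C" "\<And>x. x \<in> carrier H \<Longrightarrow> hnorm K (A x) \<le> C * hnorm H x"
proof -
  obtain C where C: "\<And>x. x \<in> carrier H \<Longrightarrow> hnorm K (A x) \<le> C * hnorm H x"
    using assms by (auto simp: bounded_operators_def)
  show thesis
  \<comment> \<open>The constant in \<open>bounded_operators\<close> carries no sign condition;
    norms in \<open>H\<close> being nonnegative, its absolute value still bounds.\<close>
  proof (rule that [of "\<bar>C\<bar>"])
    fix x assume x: "x \<in> carrier H"
    have "C * hnorm H x \<le> \<bar>C\<bar> * hnorm H x"
      using x by (intro mult_right_mono) auto
    with C [OF x] show "hnorm K (A x) \<le> \<bar>C\<bar> * hnorm H x" by linarith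
  qed simp
qed

lemma complex_hilbert_spaceI:
  assumes "hmetric.mcomplete"
  shows "complex_hilbert_space H"
  by unfold_locales
    (fact cinner_commute cinner_add_left cinner_smult_left cinner_pos assms)+

text \<open>Testing against the difference of \<open>y\<close> and \<open>z\<close> shows that its
  norm is 0. This is the uniqueness behind the \<open>THE\<close> in
  \<open>hadjoint\<close>.\<close>

lemma cinner_eqI:
  assumes "y \<in> carrier H" "z \<in> carrier H"
    and "\<And>x. x \<in> carrier H \<Longrightarrow> cinner H x y = cinner H x z"
  shows "y = z"
proof -
  have "cinner H (y \<ominus> z) (y \<ominus> z) = 0"
    using assms by (simp add: cinner_minus_right)
  then have "hnorm H (y \<ominus> z) = 0" by (simp add: hnorm_def)
  then show ?thesis using assms(1,2) by (simp add: hnorm_eq_0_iff)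
qed

section \<open>Subspaces, unit vectors and the minimum modulus\<close>

lemma pre_hilbert_subspace:
  assumes "VectorSpace.subspace class_ring M H"
  shows "pre_hilbert_space (H\<lparr>carrier := M\<rparr>)"
proof -
  have "M \<subseteq> carrier H"
    using assms by (simp add: VectorSpace.subspace_def submodule_def)
  then show ?thesis
    using subspace_is_vs [OF assms]
    by (intro pre_hilbert_space.intro pre_hilbert_space_axioms.intro)
      (auto simp: subset_iff cinner_add_left cinner_smult_left intro: cinner_commute cinner_pos)
qed

text \<open>Negation is defined through the carrier, so subtraction changes formally with the
  record. Expanding squared norms into inner products avoids identifying the two
  differences.\<close>

lemma hnorm_minus_subspace:
  assumes "VectorSpace.subspace class_ring M H" "x \<in> M" "y \<in> M"
  shows "hnorm H (x \<ominus>\<^bsub>H\<lparr>carrier := M\<rparr>\<^esub> y) = hnorm H (x \<ominus> y)"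
proof -
  interpret M: pre_hilbert_space "H\<lparr>carrier := M\<rparr>"
    using assms(1) by (rule pre_hilbert_subspace)
  have sub: "M \<subseteq> carrier H"
    using assms by (simp add: VectorSpace.subspace_def submodule_def)
  have "x \<ominus>\<^bsub>H\<lparr>carrier := M\<rparr>\<^esub> y \<in> M"
    using M.minus_closed [of x y] assms by simp
  then show ?thesis
    using M.hnorm_minus_sq [of x y] hnorm_minus_sq [of x y] M.hnorm_nonneg assms sub
    by (simp add: subset_iff power2_eq_imp_eq)
qed

lemma scaled_unit_vector:
  assumes M: "VectorSpace.subspace class_ring M H" and x: "x \<in> M" "x \<noteq> \<zero>"
  obtains u where "u \<in> M" "hnorm H u = 1" "x = of_real (hnorm H x) \<odot>\<^bsub>H\<^esub> u"
proof -
  have xH: "x \<in> carrier H"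
    using M x by (auto simp: VectorSpace.subspace_def submodule_def)
  have pos: "hnorm H x > 0" using hnorm_pos [OF xH x(2)] .
  let ?u = "of_real (1 / hnorm H x) \<odot>\<^bsub>H\<^esub> x"
  show thesis
  proof
    show "?u \<in> M" using M x by (auto simp: VectorSpace.subspace_def submodule_def)
    show "hnorm H ?u = 1" using pos xH by (simp add: hnorm_smult norm_divide)
    show "x = of_real (hnorm H x) \<odot>\<^bsub>H\<^esub> ?u"
      using pos xH smult_assoc1 [of "of_real (hnorm H x)" "of_real (1 / hnorm H x)" x] smult_one [of x]
      by simp
  qed
qed

text \<open>By homogeneity the infimum over unit vectors controls every nonzero vector of
  \<open>M\<close>; the zero vector is treated apart.\<close>

lemma min_modulus_mult_le:
  fixes K :: "('b, 's) inner_product_space_scheme"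
  assumes K: "pre_hilbert_space K" and A: "A \<in> bounded_operators H K"
    and M: "VectorSpace.subspace class_ring M H" and x: "x \<in> M"
  shows "min_modulus (H\<lparr>carrier := M\<rparr>) K A * hnorm H x \<le> hnorm K (A x)"
proof (cases "x = \<zero>")
  case True
  then show ?thesis
    using pre_hilbert_space.hnorm_nonneg [OF K bounded_operators_in_carrier [OF A]] by simp
next
  case False
  have sub: "M \<subseteq> carrier H" using M by (simp add: VectorSpace.subspace_def submodule_def)
  note nonneg = pre_hilbert_space.hnorm_nonneg [OF K bounded_operators_in_carrier [OF A]]
  obtain u where u: "u \<in> M" "hnorm H u = 1" "x = of_real (hnorm H x) \<odot>\<^bsub>H\<^esub> u"
    using scaled_unit_vector [OF M x False] .
  have uH: "u \<in> carrier H" and xH: "x \<in> carrier H" using sub u x by auto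
  have "min_modulus (H\<lparr>carrier := M\<rparr>) K A \<le> hnorm K (A u)"
    unfolding min_modulus_def
    by (rule cInf_lower) (use u nonneg sub in \<open>auto intro!: bdd_belowI [of _ 0]\<close>)
  moreover have "hnorm K (A x) = hnorm H x * hnorm K (A u)"
    using pre_hilbert_space.hnorm_smult [OF K bounded_operators_in_carrier [OF A uH]]
      bounded_operators_smult [OF A uH] u(3) xH
    by (metis abs_of_nonneg hnorm_nonneg norm_of_real)
  ultimately show ?thesis
    using xH by (simp add: mult.commute mult_left_mono)
qed

text \<open>\<open>G\<close> is an arbitrary set because it will consist of eigenvectors for various
  eigenvalues, which need not form a subspace. Closedness comes from continuity of the inner
  product.\<close>

lemma closed_subspace_orthogonal:
  assumes G: "G \<subseteq> carrier H"
  shows "closed_subspace {x \<in> carrier H. \<forall>g\<in>G. cinner H x g = 0} H"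
proof -
  let ?N = "{x \<in> carrier H. \<forall>g\<in>G. cinner H x g = 0}"
  have "submodule class_ring ?N H"
    using G by unfold_locales (auto simp: cinner_simps subset_iff)
  then have "VectorSpace.subspace class_ring ?N H"
    by (intro subspace.intro vectorspace_axioms)
  moreover have "closedin (htopology H) ?N"
    unfolding closedin_htopology
  proof (intro conjI allI impI)
    fix \<sigma> l
    assume *: "range \<sigma> \<subseteq> ?N \<and> l \<in> carrier H \<and> (\<lambda>n. hnorm H (\<sigma> n \<ominus> l)) \<longlonglongrightarrow> 0"
    then have \<sigma>: "range \<sigma> \<subseteq> carrier H" by auto
    have "cinner H l g = 0" if g: "g \<in> G" for g
    proof (rule LIMSEQ_unique)
      show "(\<lambda>n. cinner H (\<sigma> n) g) \<longlonglongrightarrow> cinner H l g"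
        using tendsto_cinner [OF \<sigma>] * g G by auto
      have "cinner H (\<sigma> n) g = 0" for n using * g by auto
      then show "(\<lambda>n. cinner H (\<sigma> n) g) \<longlonglongrightarrow> 0" by simp
    qed
    then show "l \<in> ?N" using * by auto
  qed auto
  ultimately show ?thesis by (simp add: closed_subspace_def)
qed

end

section \<open>Riesz representation and adjoints\<close>

context complex_hilbert_space
begin

text \<open>The representing vector is the minimizer of \<open>\<Phi> x = \<parallel>x\<parallel>\<^sup>2 - 2 Re (f x)\<close>.\<close>

lemma riesz_representation:
  assumes add: "\<And>x y. x \<in> carrier H \<Longrightarrow> y \<in> carrier H \<Longrightarrow> f (x \<oplus> y) = f x + f y"
    and smult: "\<And>c x. x \<in> carrier H \<Longrightarrow> f (c \<odot>\<^bsub>H\<^esub> x) = c * f x"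
    and bound: "\<And>x. x \<in> carrier H \<Longrightarrow> cmod (f x) \<le> C * hnorm H x"
  obtains z where "z \<in> carrier H" "\<And>x. x \<in> carrier H \<Longrightarrow> f x = cinner H x z"
proof -
  define \<Phi> where "\<Phi> x = (hnorm H x)\<^sup>2 - 2 * Re (f x)" for x
  define m where "m = Inf (\<Phi> ` carrier H)"
  have Re_f: "\<bar>Re (f x)\<bar> \<le> C * hnorm H x" if "x \<in> carrier H" for x
    using bound [OF that] abs_Re_le_cmod [of "f x"] by linarith
  have bdd: "bdd_below (\<Phi> ` carrier H)"
  proof (rule bdd_belowI2)
    fix x assume x: "x \<in> carrier H"
    \<comment> \<open>Completing the square shows that \<Phi> is bounded below.\<close>
    have "0 \<le> (hnorm H x - C)\<^sup>2" by simp
    also have "\<dots> \<le> \<Phi> x + C\<^sup>2"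
      using Re_f [OF x] by (simp add: \<Phi>_def power2_diff mult.commute)
    finally show "- C\<^sup>2 \<le> \<Phi> x" by simp
  qed
  have m_le: "m \<le> \<Phi> x" if "x \<in> carrier H" for x
    unfolding m_def using bdd that by (intro cInf_lower) auto
  have half: "Re (f (of_real (1/2) \<odot>\<^bsub>H\<^esub> x)) = Re (f x) / 2"
    "(hnorm H (of_real (1/2) \<odot>\<^bsub>H\<^esub> x))\<^sup>2 = (hnorm H x)\<^sup>2 / 4" if "x \<in> carrier H" for x
    using that smult hnorm_smult by (simp_all add: power_mult_distrib power_divide norm_divide)
  \<comment> \<open>Parallelogram law, with \<Phi> at least \<open>m\<close> at the midpoint:
    vectors that nearly minimize \<Phi> are close to each other.\<close>
  have gap: "(hnorm H (x \<ominus> y))\<^sup>2 \<le> 2 * (\<Phi> x - m) + 2 * (\<Phi> y - m)"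
    if x: "x \<in> carrier H" and y: "y \<in> carrier H" for x y
  proof -
    have "4 * m \<le> 4 * \<Phi> (of_real (1/2) \<odot>\<^bsub>H\<^esub> (x \<oplus> y))"
      using m_le x y by simp
    also have "\<dots> = (hnorm H (x \<oplus> y))\<^sup>2 - 4 * (Re (f x) + Re (f y))"
      using half [of "x \<oplus> y"] x y add [OF x y] by (simp add: \<Phi>_def)
    finally show ?thesis
      using x y by (simp add: hnorm_add_sq hnorm_minus_sq \<Phi>_def)
  qed
  have "\<exists>x\<in>carrier H. \<Phi> x < m + 1 / real (Suc n)" for n
  proof -
    have "m < m + 1 / real (Suc n)" by simp
    then show ?thesis
      using cInf_lessD [of "\<Phi> ` carrier H" "m + 1 / real (Suc n)"] zero_closed unfolding m_def by blast
  qed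
  then obtain \<sigma> where \<sigma>: "\<And>n. \<sigma> n \<in> carrier H" "\<And>n. \<Phi> (\<sigma> n) < m + 1 / real (Suc n)"
    by metis
  have "hmetric.MCauchy \<sigma>"
    unfolding MCauchy_hdist
  proof (intro conjI allI impI)
    show "range \<sigma> \<subseteq> carrier H" using \<sigma>(1) by auto
    fix \<epsilon> :: real assume \<epsilon>: "0 < \<epsilon>"
    \<comment> \<open>The quarter compensates for the two terms with factor 2 in
      \<open>gap\<close>.\<close>
    then obtain N where N: "inverse (real (Suc N)) < \<epsilon>\<^sup>2 / 4"
      using reals_Archimedean [of "\<epsilon>\<^sup>2 / 4"] by auto
    have close: "\<Phi> (\<sigma> n) - m < \<epsilon>\<^sup>2 / 4" if "N \<le> n" for n
    proof -
      have "1 / real (Suc n) \<le> inverse (real (Suc N))"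
        using that by (simp add: field_simps)
      then show ?thesis using \<sigma>(2) [of n] N by linarith
    qed
    have "hnorm H (\<sigma> n \<ominus> \<sigma> n') < \<epsilon>" if "N \<le> n" "N \<le> n'" for n n'
    proof (rule power_less_imp_less_base)
      show "(hnorm H (\<sigma> n \<ominus> \<sigma> n'))\<^sup>2 < \<epsilon>\<^sup>2"
      proof -
        have "2 * (\<Phi> (\<sigma> n) - m) + 2 * (\<Phi> (\<sigma> n') - m) < \<epsilon>\<^sup>2"
          using close [OF that(1)] close [OF that(2)] by (simp add: field_simps)
        then show ?thesis
          using gap [OF \<sigma>(1) \<sigma>(1), of n n'] by (rule le_less_trans [rotated])
      qed
    qed (use \<epsilon> in simp)
    then show "\<exists>N. \<forall>n n'. N \<le> n \<longrightarrow> N \<le> n' \<longrightarrow> hnorm H (\<sigma> n \<ominus> \<sigma> n') < \<epsilon>" by blast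
  qed
  then obtain z where z: "z \<in> carrier H" and lim: "(\<lambda>n. hnorm H (\<sigma> n \<ominus> z)) \<longlonglongrightarrow> 0"
    using complete mcomplete_hdist by blast
  \<comment> \<open>Continuity of \<Phi> at \<open>z\<close>, in the needed direction only: \<Phi> z
    exceeds \<Phi> (\<sigma> n) by at most a multiple of the distance, and the resulting bound tends
    to \<open>m\<close>.\<close>
  have "\<Phi> z \<le> m"
  proof (rule LIMSEQ_le_const)
    show "(\<lambda>n. m + 1 / real (Suc n) + 2 * (hnorm H z + C) * hnorm H (\<sigma> n \<ominus> z)) \<longlonglongrightarrow> m"
      using tendsto_add [OF tendsto_add [OF tendsto_const [of m] lim_1_over_n [THEN LIMSEQ_Suc]]
          tendsto_mult_right_zero [OF lim, of "2 * (hnorm H z + C)"]]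
      by simp
    have "\<Phi> z \<le> m + 1 / real (Suc n) + 2 * (hnorm H z + C) * hnorm H (\<sigma> n \<ominus> z)" for n
    proof -
      define d where "d = \<sigma> n \<ominus> z"
      have d: "d \<in> carrier H" and \<sigma>d: "\<sigma> n = z \<oplus> d"
        using \<sigma>(1) [of n] z a_lcomm [of z "\<sigma> n" "\<ominus> z"] by (simp_all add: d_def a_minus_def r_neg)
      have "- (hnorm H z * hnorm H d) \<le> Re (cinner H z d)"
        using norm_cinner_le [OF z d] abs_Re_le_cmod [of "cinner H z d"] by linarith
      moreover have "\<Phi> (\<sigma> n) = \<Phi> z + (hnorm H d)\<^sup>2 + 2 * Re (cinner H z d) - 2 * Re (f d)"
        unfolding \<sigma>d by (simp add: \<Phi>_def hnorm_add_sq [OF z d] add [OF z d])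
      moreover have "Re (f d) \<le> C * hnorm H d" using Re_f [OF d] by linarith
      moreover have "0 \<le> (hnorm H d)\<^sup>2" by simp
      moreover have "2 * (hnorm H z + C) * hnorm H d = 2 * (hnorm H z * hnorm H d) + 2 * (C * hnorm H d)"
        by (simp add: algebra_simps)
      ultimately have "\<Phi> z \<le> \<Phi> (\<sigma> n) + 2 * (hnorm H z + C) * hnorm H d"
        by linarith
      then show ?thesis using \<sigma>(2) [of n] by (simp add: d_def)
    qed
    then show "\<exists>N. \<forall>n\<ge>N. \<Phi> z \<le>
        m + 1 / real (Suc n) + 2 * (hnorm H z + C) * hnorm H (\<sigma> n \<ominus> z)" by blast
  qed
  \<comment> \<open>The first variation of \<Phi> at its minimizer \<open>z\<close> in direction
    \<open>w\<close> must vanish.\<close>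
  have Re_eq: "Re (f w) = Re (cinner H w z)" if w: "w \<in> carrier H" for w
  proof -
    have "0 \<le> 2 * t * (Re (cinner H z w) - Re (f w)) + t\<^sup>2 * (hnorm H w)\<^sup>2" for t
    proof -
      have "\<Phi> z \<le> \<Phi> (z \<oplus> of_real t \<odot>\<^bsub>H\<^esub> w)"
        using \<open>\<Phi> z \<le> m\<close> m_le [of "z \<oplus> of_real t \<odot>\<^bsub>H\<^esub> w"] z w by auto
      then show ?thesis
        using z w by (simp add: \<Phi>_def hnorm_add_smult_sq add smult algebra_simps)
    qed
    then have "Re (cinner H z w) - Re (f w) = 0" by (rule linear_term_eq_0)
    then show ?thesis using cinner_commute [OF z w] by simp
  qed
  show thesis
  proof (rule that [OF z])
    fix w assume w: "w \<in> carrier H"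
    \<comment> \<open>Multiplying the argument by the imaginary unit turns imaginary parts into
      negated real parts.\<close>
    have "Im (f w) = Im (cinner H w z)"
      using Re_eq [of "\<i> \<odot>\<^bsub>H\<^esub> w"] w z by (simp add: smult cinner_smult_left)
    then show "f w = cinner H w z" using Re_eq [OF w] by (simp add: complex_eq_iff)
  qed
qed

text \<open>By Cauchy-Schwarz, pairing \<open>T x\<close> with \<open>y\<close> is a bounded linear
  functional of \<open>x\<close>; Riesz gives a representative and \<open>cinner_eqI\<close> makes
  it unique, so the description in \<open>hadjoint\<close> denotes.\<close>

lemma hadjoint:
  assumes T: "T \<in> bounded_operators H H" and y: "y \<in> carrier H"
  shows hadjoint_in_carrier: "hadjoint H T y \<in> carrier H"
    and cinner_hadjoint: "x \<in> carrier H \<Longrightarrow> cinner H x (hadjoint H T y) = cinner H (T x) y"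
proof -
  obtain C where C: "\<And>x. x \<in> carrier H \<Longrightarrow> hnorm H (T x) \<le> C * hnorm H x"
    using bounded_operators_bound [OF T] by blast
  have bound: "cmod (cinner H (T x) y) \<le> C * hnorm H y * hnorm H x" if "x \<in> carrier H" for x
    using norm_cinner_le [OF bounded_operators_in_carrier [OF T that] y]
      mult_right_mono [OF C [OF that] hnorm_nonneg [OF y]] by (simp add: ac_simps)
  obtain z where z: "z \<in> carrier H" "\<And>x. x \<in> carrier H \<Longrightarrow> cinner H (T x) y = cinner H x z"
  proof (rule riesz_representation [where f = "\<lambda>x. cinner H (T x) y" and C = "C * hnorm H y"])
  qed (use T y bound in \<open>auto simp: bounded_operators_add bounded_operators_smult
      bounded_operators_in_carrier cinner_add_left cinner_smult_left\<close>)
  have "\<exists>!z. z \<in> carrier H \<and> (\<forall>x\<in>carrier H. cinner H (T x) y = cinner H x z)"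
    using z by (intro ex1I [of _ z]) (auto intro: cinner_eqI)
  then have "hadjoint H T y \<in> carrier H \<and>
      (\<forall>x\<in>carrier H. cinner H (T x) y = cinner H x (hadjoint H T y))"
    unfolding hadjoint_def by (rule theI')
  then show "hadjoint H T y \<in> carrier H"
    and "x \<in> carrier H \<Longrightarrow> cinner H x (hadjoint H T y) = cinner H (T x) y"
    by auto
qed

text \<open>Cauchy sequences of \<open>M\<close> converge in \<open>H\<close>, and the limit stays
  in \<open>M\<close>. Riesz representation inside \<open>M\<close> then supplies orthogonal
  projections.\<close>

lemma complex_hilbert_closed_subspace:
  assumes "closed_subspace M H"
  shows "complex_hilbert_space (H\<lparr>carrier := M\<rparr>)"
proof -
  have sub: "VectorSpace.subspace class_ring M H" and M: "M \<subseteq> carrier H"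
    using assms by (auto simp: closed_subspace_def VectorSpace.subspace_def submodule_def)
  interpret M: pre_hilbert_space "H\<lparr>carrier := M\<rparr>"
    using sub by (rule pre_hilbert_subspace)
  show ?thesis
  proof (rule M.complex_hilbert_spaceI, unfold M.mcomplete_hdist, intro allI impI)
    fix \<sigma> assume \<sigma>: "M.hmetric.MCauchy \<sigma>"
    then have \<sigma>M: "range \<sigma> \<subseteq> M" unfolding M.MCauchy_hdist by simp
    then have diff: "hnorm H (\<sigma> n \<ominus>\<^bsub>H\<lparr>carrier := M\<rparr>\<^esub> l) = hnorm H (\<sigma> n \<ominus> l)" if "l \<in> M" for n l
      using hnorm_minus_subspace [OF sub] that by auto
    have "hmetric.MCauchy \<sigma>"
      using \<sigma> \<sigma>M M unfolding MCauchy_hdist M.MCauchy_hdist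
      by (auto simp: diff image_subset_iff)
    then obtain l where l: "l \<in> carrier H" "(\<lambda>n. hnorm H (\<sigma> n \<ominus> l)) \<longlonglongrightarrow> 0"
      using complete mcomplete_hdist by blast
    then have "l \<in> M"
      using assms \<sigma>M unfolding closed_subspace_def closedin_htopology by blast
    with l(2) show "\<exists>l\<in>carrier (H\<lparr>carrier := M\<rparr>).
        (\<lambda>n. hnorm (H\<lparr>carrier := M\<rparr>) (\<sigma> n \<ominus>\<^bsub>H\<lparr>carrier := M\<rparr>\<^esub> l)) \<longlonglongrightarrow> 0"
      by (auto simp: diff)
  qed
qed

end

section \<open>Finite Hilbert sums\<close>

lemma hilbert_sum_simps [simp]:
  "carrier (hilbert_sum I H) = (\<Pi>\<^sub>E j\<in>I. carrier (H j))"
  "zero (hilbert_sum I H) = (\<lambda>j\<in>I. \<zero>\<^bsub>H j\<^esub>)"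
  "x \<oplus>\<^bsub>hilbert_sum I H\<^esub> y = (\<lambda>j\<in>I. x j \<oplus>\<^bsub>H j\<^esub> y j)"
  "c \<odot>\<^bsub>hilbert_sum I H\<^esub> x = (\<lambda>j\<in>I. c \<odot>\<^bsub>H j\<^esub> x j)"
  "cinner (hilbert_sum I H) x y = (\<Sum>j\<in>I. cinner (H j) (x j) (y j))"
  by (simp_all add: hilbert_sum_def)

lemma hilbert_sum_vectorspace:
  fixes H :: "'i \<Rightarrow> ('a, 'r) inner_product_space_scheme"
  assumes "\<And>j. j \<in> I \<Longrightarrow> pre_hilbert_space (H j)"
  shows "vectorspace (class_ring :: complex ring) (hilbert_sum I H)"
proof -
  let ?S = "hilbert_sum I H"
  have V: "vectorspace (class_ring :: complex ring) (H j)" if "j \<in> I" for j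
    using assms [OF that] by (rule pre_hilbert_space.axioms)
  then have M: "Module.module (class_ring :: complex ring) (H j)" if "j \<in> I" for j
    using that by (simp add: vectorspace_def)
  then have G: "abelian_group (H j)" if "j \<in> I" for j
    using that by (simp add: Module.module_def)
  then have N: "abelian_monoid (H j)" if "j \<in> I" for j
    using that by (simp add: abelian_group_def)
  have "abelian_group ?S"
  proof (rule abelian_groupI)
    fix x assume x: "x \<in> carrier ?S"
    have "(\<lambda>j\<in>I. \<ominus>\<^bsub>H j\<^esub> x j) \<in> carrier ?S"
      using x G by (auto simp: PiE_iff abelian_group.a_inv_closed)
    moreover have "(\<lambda>j\<in>I. \<ominus>\<^bsub>H j\<^esub> x j) \<oplus>\<^bsub>?S\<^esub> x = \<zero>\<^bsub>?S\<^esub>"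
      using x G by (auto simp: PiE_iff abelian_group.l_neg)
    ultimately show "\<exists>y\<in>carrier ?S. y \<oplus>\<^bsub>?S\<^esub> x = \<zero>\<^bsub>?S\<^esub>" by blast
  next
    fix x y assume "x \<in> carrier ?S" "y \<in> carrier ?S"
    then show "x \<oplus>\<^bsub>?S\<^esub> y = y \<oplus>\<^bsub>?S\<^esub> x"
      using N by (auto simp: PiE_iff abelian_monoid.a_comm)
  next
    fix x assume "x \<in> carrier ?S"
    then show "\<zero>\<^bsub>?S\<^esub> \<oplus>\<^bsub>?S\<^esub> x = x"
      using N by (auto simp: PiE_iff abelian_monoid.l_zero extensional_def)
  qed (use N in \<open>auto simp: PiE_iff abelian_monoid.a_closed abelian_monoid.zero_closed
      abelian_monoid.a_assoc\<close>)
  moreover have "module_axioms (class_ring :: complex ring) ?S"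
  proof
    fix x assume "x \<in> carrier ?S"
    then show "\<one>\<^bsub>class_ring\<^esub> \<odot>\<^bsub>?S\<^esub> x = x"
      using Module.module.smult_one [OF M] by (auto simp: PiE_iff extensional_def)
  qed (use Module.module.smult_closed [OF M] Module.module.smult_l_distr [OF M]
      Module.module.smult_r_distr [OF M] Module.module.smult_assoc1 [OF M]
      in \<open>auto simp: PiE_iff\<close>)
  ultimately show ?thesis
    using class_field by (simp add: vectorspace_def Module.module_def field_def domain_def)
qed

lemma hilbert_sum_pre_hilbert:
  fixes H :: "'i \<Rightarrow> ('a, 'r) inner_product_space_scheme"
  assumes I: "finite I" and H: "\<And>j. j \<in> I \<Longrightarrow> pre_hilbert_space (H j)"
  shows "pre_hilbert_space (hilbert_sum I H)"
proof (intro pre_hilbert_space.intro pre_hilbert_space_axioms.intro)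
  let ?S = "hilbert_sum I H"
  show "vectorspace (class_ring :: complex ring) ?S"
    using H by (rule hilbert_sum_vectorspace)
  fix x y assume x: "x \<in> carrier ?S" and y: "y \<in> carrier ?S"
  show "cinner ?S x y = cnj (cinner ?S y x)"
    using x y by (auto intro!: sum.cong pre_hilbert_space.cinner_commute [OF H])
  show "cinner ?S (c \<odot>\<^bsub>?S\<^esub> x) y = c * cinner ?S x y" for c
    using x y
    by (auto simp: sum_distrib_left intro!: sum.cong pre_hilbert_space.cinner_smult_left [OF H])
  show "cinner ?S (x \<oplus>\<^bsub>?S\<^esub> y) z = cinner ?S x z + cinner ?S y z" if "z \<in> carrier ?S" for z
    unfolding hilbert_sum_simps sum.distrib [symmetric]
    by (rule sum.cong)
      (use x y that in \<open>auto intro: pre_hilbert_space.cinner_add_left [OF H]\<close>)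
next
  let ?S = "hilbert_sum I H"
  fix x assume x: "x \<in> carrier ?S" "x \<noteq> \<zero>\<^bsub>?S\<^esub>"
  then obtain j where j: "j \<in> I" "x j \<noteq> \<zero>\<^bsub>H j\<^esub>"
    by (auto simp: PiE_iff extensional_def fun_eq_iff split: if_splits)
  have "0 < (\<Sum>j\<in>I. Re (cinner (H j) (x j) (x j)))"
  proof (rule sum_pos2 [OF I j(1)])
    show "0 < Re (cinner (H j) (x j) (x j))"
      using pre_hilbert_space.cinner_pos [OF H [OF j(1)]] j x(1) by auto
    show "0 \<le> Re (cinner (H i) (x i) (x i))" if "i \<in> I" for i
      using pre_hilbert_space.Re_cinner_self_nonneg [OF H [OF that]] that x(1) by auto
  qed
  then show "0 < Re (cinner ?S x x)" by simp
qed

lemma hnorm_hilbert_sum_sq: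
  assumes I: "finite I" and H: "\<And>j. j \<in> I \<Longrightarrow> pre_hilbert_space (H j)"
    and x: "x \<in> carrier (hilbert_sum I H)"
  shows "(hnorm (hilbert_sum I H) x)\<^sup>2 = (\<Sum>j\<in>I. (hnorm (H j) (x j))\<^sup>2)"
proof -
  have "(hnorm (H j) (x j))\<^sup>2 = Re (cinner (H j) (x j) (x j))" if "j \<in> I" for j
    using pre_hilbert_space.hnorm_sq [OF H] that x by auto
  then show ?thesis
    using pre_hilbert_space.hnorm_sq [OF hilbert_sum_pre_hilbert [OF I H] x] by simp
qed

text \<open>Negation in the sum is not componentwise by definition; expanding both sides into inner
  products spares computing it.\<close>

lemma hnorm_minus_hilbert_sum_sq:
  assumes I: "finite I" and H: "\<And>j. j \<in> I \<Longrightarrow> pre_hilbert_space (H j)"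
    and x: "x \<in> carrier (hilbert_sum I H)" and y: "y \<in> carrier (hilbert_sum I H)"
  shows "(hnorm (hilbert_sum I H) (x \<ominus>\<^bsub>hilbert_sum I H\<^esub> y))\<^sup>2 =
    (\<Sum>j\<in>I. (hnorm (H j) (x j \<ominus>\<^bsub>H j\<^esub> y j))\<^sup>2)"
proof -
  have "(\<Sum>j\<in>I. (hnorm (H j) (x j \<ominus>\<^bsub>H j\<^esub> y j))\<^sup>2) =
      (\<Sum>j\<in>I. (hnorm (H j) (x j))\<^sup>2 - 2 * Re (cinner (H j) (x j) (y j)) + (hnorm (H j) (y j))\<^sup>2)"
    by (rule sum.cong [OF refl], rule pre_hilbert_space.hnorm_minus_sq [OF H]) (use x y in auto)
  then show ?thesis
    using pre_hilbert_space.hnorm_minus_sq [OF hilbert_sum_pre_hilbert [OF I H] x y]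
      hnorm_hilbert_sum_sq [OF I H x] hnorm_hilbert_sum_sq [OF I H y]
    by (simp add: sum.distrib sum_subtractf sum_distrib_left)
qed

text \<open>A Cauchy sequence is Cauchy in each coordinate. The coordinate limits form a tuple, and
  finitely many squared errors tend to 0 together.\<close>

lemma complex_hilbert_hilbert_sum:
  fixes H :: "'i \<Rightarrow> ('a, 'r) inner_product_space_scheme"
  assumes I: "finite I" and H: "\<And>j. j \<in> I \<Longrightarrow> complex_hilbert_space (H j)"
  shows "complex_hilbert_space (hilbert_sum I H)"
proof -
  let ?S = "hilbert_sum I H"
  have pre: "pre_hilbert_space (H j)" if "j \<in> I" for j
  proof -
    interpret complex_hilbert_space "H j" using that by (rule H)
    show ?thesis by (rule pre_hilbert_space_axioms)
  qed
  interpret S: pre_hilbert_space ?S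
    using I pre by (rule hilbert_sum_pre_hilbert)
  note diff_sq = hnorm_minus_hilbert_sum_sq [OF I pre]
  show ?thesis
  proof (rule S.complex_hilbert_spaceI, unfold S.mcomplete_hdist, intro allI impI)
    fix \<sigma> assume \<sigma>: "S.hmetric.MCauchy \<sigma>"
    then have \<sigma>S: "\<sigma> n \<in> carrier ?S" for n
      unfolding S.MCauchy_hdist by blast
    have "\<exists>l\<in>carrier (H j). (\<lambda>n. hnorm (H j) (\<sigma> n j \<ominus>\<^bsub>H j\<^esub> l)) \<longlonglongrightarrow> 0" if j: "j \<in> I" for j
    proof -
      interpret Hj: complex_hilbert_space "H j" using j by (rule H)
      have \<sigma>j: "\<sigma> n j \<in> carrier (H j)" for n using \<sigma>S [of n] j by auto
      have le: "hnorm (H j) (\<sigma> n j \<ominus>\<^bsub>H j\<^esub> \<sigma> n' j) \<le> hnorm ?S (\<sigma> n \<ominus>\<^bsub>?S\<^esub> \<sigma> n')" for n n'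
      proof (rule power2_le_imp_le)
        show "(hnorm (H j) (\<sigma> n j \<ominus>\<^bsub>H j\<^esub> \<sigma> n' j))\<^sup>2 \<le> (hnorm ?S (\<sigma> n \<ominus>\<^bsub>?S\<^esub> \<sigma> n'))\<^sup>2"
          unfolding diff_sq [OF _ \<sigma>S \<sigma>S, simplified]
          using I j by (intro member_le_sum) auto
        show "0 \<le> hnorm ?S (\<sigma> n \<ominus>\<^bsub>?S\<^esub> \<sigma> n')"
          using S.minus_closed [OF \<sigma>S \<sigma>S] by (rule S.hnorm_nonneg)
      qed
      have "Hj.hmetric.MCauchy (\<lambda>n. \<sigma> n j)"
        unfolding Hj.MCauchy_hdist
      proof (intro conjI allI impI)
        show "range (\<lambda>n. \<sigma> n j) \<subseteq> carrier (H j)" using \<sigma>j by auto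
        fix \<epsilon> :: real assume "0 < \<epsilon>"
        then obtain N where "\<And>n n'. N \<le> n \<Longrightarrow> N \<le> n' \<Longrightarrow> hnorm ?S (\<sigma> n \<ominus>\<^bsub>?S\<^esub> \<sigma> n') < \<epsilon>"
          using \<sigma> unfolding S.MCauchy_hdist by blast
        then show "\<exists>N. \<forall>n n'. N \<le> n \<longrightarrow> N \<le> n' \<longrightarrow> hnorm (H j) (\<sigma> n j \<ominus>\<^bsub>H j\<^esub> \<sigma> n' j) < \<epsilon>"
          using le le_less_trans by blast
      qed
      then show ?thesis
        using Hj.complete Hj.mcomplete_hdist by blast
    qed
    then obtain l where l: "\<And>j. j \<in> I \<Longrightarrow> l j \<in> carrier (H j)"
      "\<And>j. j \<in> I \<Longrightarrow> (\<lambda>n. hnorm (H j) (\<sigma> n j \<ominus>\<^bsub>H j\<^esub> l j)) \<longlonglongrightarrow> 0"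
      by metis
    \<comment> \<open>The chosen \<open>l\<close> is arbitrary off \<open>I\<close>; restricting it
      gives an extensional tuple.\<close>
    let ?l = "restrict l I"
    have lS: "?l \<in> carrier ?S" using l(1) by auto
    have "(\<lambda>n. \<Sum>j\<in>I. (hnorm (H j) (\<sigma> n j \<ominus>\<^bsub>H j\<^esub> l j))\<^sup>2) \<longlonglongrightarrow> (\<Sum>j\<in>I. 0\<^sup>2)"
      using l(2) by (intro tendsto_sum tendsto_power) auto
    moreover have "(\<Sum>j\<in>I. (hnorm (H j) (\<sigma> n j \<ominus>\<^bsub>H j\<^esub> l j))\<^sup>2) = (hnorm ?S (\<sigma> n \<ominus>\<^bsub>?S\<^esub> ?l))\<^sup>2" for n
      using diff_sq [OF _ \<sigma>S lS] by (simp cong: sum.cong)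
    ultimately have "(\<lambda>n. (hnorm ?S (\<sigma> n \<ominus>\<^bsub>?S\<^esub> ?l))\<^sup>2) \<longlonglongrightarrow> 0" by simp
    then have "(\<lambda>n. sqrt ((hnorm ?S (\<sigma> n \<ominus>\<^bsub>?S\<^esub> ?l))\<^sup>2)) \<longlonglongrightarrow> sqrt 0"
      by (rule tendsto_real_sqrt)
    then have "(\<lambda>n. hnorm ?S (\<sigma> n \<ominus>\<^bsub>?S\<^esub> ?l)) \<longlonglongrightarrow> 0"
      using S.hnorm_nonneg [OF S.minus_closed [OF \<sigma>S lS]] by simp
    with lS show "\<exists>l\<in>carrier ?S. (\<lambda>n. hnorm ?S (\<sigma> n \<ominus>\<^bsub>?S\<^esub> l)) \<longlonglongrightarrow> 0" by blast
  qed
qed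

lemma operator_sum_bounded:
  fixes H :: "'i \<Rightarrow> ('a, 'r) inner_product_space_scheme"
  assumes I: "finite I" and H: "\<And>j. j \<in> I \<Longrightarrow> pre_hilbert_space (H j)"
    and A: "\<And>j. j \<in> I \<Longrightarrow> A j \<in> bounded_operators (H j) (H j)"
  shows "operator_sum I A \<in> bounded_operators (hilbert_sum I H) (hilbert_sum I H)"
proof -
  let ?S = "hilbert_sum I H" and ?T = "operator_sum I A"
  interpret S: pre_hilbert_space ?S
    using I H by (rule hilbert_sum_pre_hilbert)
  have hom: "?T \<in> LinearCombinations.module_hom (class_ring :: complex ring) ?S ?S"
    by (auto simp: LinearCombinations.module_hom_def operator_sum_def PiE_iff
        bounded_operators_add [OF A] bounded_operators_smult [OF A] bounded_operators_in_carrier [OF A])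
  have "\<exists>C\<ge>0. \<forall>x\<in>carrier (H j). hnorm (H j) (A j x) \<le> C * hnorm (H j) x" if "j \<in> I" for j
    using pre_hilbert_space.bounded_operators_bound [OF H A] that by metis
  then obtain C where C: "\<And>j. j \<in> I \<Longrightarrow> 0 \<le> C j"
    "\<And>j x. j \<in> I \<Longrightarrow> x \<in> carrier (H j) \<Longrightarrow> hnorm (H j) (A j x) \<le> C j * hnorm (H j) x"
    by metis
  \<comment> \<open>The sum of the nonnegative constants dominates each of them and so is a common
    bound for all coordinates.\<close>
  have sum_nonneg: "0 \<le> sum C I" using C(1) by (rule sum_nonneg)
  have "hnorm ?S (?T x) \<le> sum C I * hnorm ?S x" if x: "x \<in> carrier ?S" for x
  proof (rule power2_le_imp_le)
    have Tx: "?T x \<in> carrier ?S" using hom x by (auto simp: LinearCombinations.module_hom_def)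
    have "(hnorm ?S (?T x))\<^sup>2 = (\<Sum>j\<in>I. (hnorm (H j) (A j (x j)))\<^sup>2)"
      using hnorm_hilbert_sum_sq [OF I H Tx] by (simp add: operator_sum_def)
    also have "\<dots> \<le> (\<Sum>j\<in>I. (sum C I * hnorm (H j) (x j))\<^sup>2)"
    proof (intro sum_mono power_mono)
      fix j assume j: "j \<in> I"
      have xj: "x j \<in> carrier (H j)" using x j by auto
      note nonneg = pre_hilbert_space.hnorm_nonneg [OF H [OF j]]
      show "0 \<le> hnorm (H j) (A j (x j))"
        using nonneg bounded_operators_in_carrier [OF A [OF j] xj] by blast
      have "C j \<le> sum C I" using I j C(1) by (intro member_le_sum) auto
      then have "C j * hnorm (H j) (x j) \<le> sum C I * hnorm (H j) (x j)"
        using nonneg [OF xj] by (rule mult_right_mono)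
      then show "hnorm (H j) (A j (x j)) \<le> sum C I * hnorm (H j) (x j)"
        using C(2) [OF j xj] by linarith
    qed
    also have "\<dots> = (sum C I * hnorm ?S x)\<^sup>2"
      using hnorm_hilbert_sum_sq [OF I H x] by (simp add: power_mult_distrib sum_distrib_left)
    finally show "(hnorm ?S (?T x))\<^sup>2 \<le> (sum C I * hnorm ?S x)\<^sup>2" .
    show "0 \<le> sum C I * hnorm ?S x" using sum_nonneg S.hnorm_nonneg [OF x] by simp
  qed
  then show ?thesis using hom by (auto simp: bounded_operators_def)
qed

section \<open>Restriction to reducing subspaces\<close>

text \<open>Eigenvectors of \<open>A\<^sup>*A\<close> (and \<open>0\<close>), described without mentioning the adjoint.\<close>

definition low_eigenvectors ::
  "('a, 'r) inner_product_space_scheme \<Rightarrow> ('a \<Rightarrow> 'a) \<Rightarrow> real \<Rightarrow> 'a set" where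
  "low_eigenvectors H A \<theta> = {g \<in> carrier H. \<exists>\<alpha>\<le>\<theta>.
    \<forall>x\<in>carrier H. cinner H (A x) (A g) = of_real \<alpha> * cinner H x g}"

text \<open>A unit vector minimizing the norm of \<open>A\<close> on the complement \<open>N\<close>
  of the low eigenvectors is an eigenvector of A*A. An eigenvalue at most \<theta> would make it
  orthogonal to itself, so the attained minimum lies strictly above, which gives a uniform
  gap.\<close>

lemma (in complex_hilbert_space) abs_min_attaining_gap:
  assumes A: "abs_min_attaining H A"
  obtains \<epsilon> where "0 < \<epsilon>"
    "\<And>y. y \<in> carrier H \<Longrightarrow> \<forall>g\<in>low_eigenvectors H A \<theta>. cinner H y g = 0 \<Longrightarrow>
      (\<theta> + \<epsilon>) * (hnorm H y)\<^sup>2 \<le> (hnorm H (A y))\<^sup>2"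
proof -
  define N where "N = {x \<in> carrier H. \<forall>g\<in>low_eigenvectors H A \<theta>. cinner H x g = 0}"
  have closed: "closed_subspace N H"
    unfolding N_def by (rule closed_subspace_orthogonal) (auto simp: low_eigenvectors_def)
  then have sub: "VectorSpace.subspace class_ring N H" by (simp add: closed_subspace_def)
  have bA: "A \<in> bounded_operators H H" using A by (simp add: abs_min_attaining_def)
  note A_carrier = bounded_operators_in_carrier [OF bA]
  show thesis
  proof (cases "N = {\<zero>}")
    case True
    show thesis
    \<comment> \<open>Only the zero vector is concerned, so any positive constant would do.\<close>
    proof (rule that [of 1])
      fix y assume "y \<in> carrier H" "\<forall>g\<in>low_eigenvectors H A \<theta>. cinner H y g = 0"
      then have "y \<in> N" by (simp add: N_def)
      then have "y = \<zero>" using True by blast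
      then show "(\<theta> + 1) * (hnorm H y)\<^sup>2 \<le> (hnorm H (A y))\<^sup>2" by simp
    qed simp
  next
    case False
    then have "min_attaining (H\<lparr>carrier := N\<rparr>) H A"
      using A closed by (simp add: abs_min_attaining_def)
    then obtain e where e: "e \<in> N" "hnorm H e = 1"
      and min_e: "hnorm H (A e) = min_modulus (H\<lparr>carrier := N\<rparr>) H A"
      by (auto simp: min_attaining_def)
    \<comment> \<open>The squared minimum, and the prospective eigenvalue of A*A at
      \<open>e\<close>.\<close>
    define \<alpha> where "\<alpha> = (hnorm H (A e))\<^sup>2"
    have eH: "e \<in> carrier H" using e by (simp add: N_def)
    have min: "\<alpha> * (hnorm H y)\<^sup>2 \<le> (hnorm H (A y))\<^sup>2" if y: "y \<in> N" for y
    proof -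
      have yH: "y \<in> carrier H" using y by (simp add: N_def)
      have "hnorm H (A e) * hnorm H y \<le> hnorm H (A y)"
        using min_modulus_mult_le [OF pre_hilbert_space_axioms bA sub y] min_e by simp
      then have "(hnorm H (A e) * hnorm H y)\<^sup>2 \<le> (hnorm H (A y))\<^sup>2"
        using yH eH A_carrier by (intro power_mono) auto
      then show ?thesis by (simp add: \<alpha>_def power_mult_distrib)
    qed
    define s where "s = hadjoint H A (A e)"
    have sH: "s \<in> carrier H" and cinner_s: "\<And>x. x \<in> carrier H \<Longrightarrow> cinner H x s = cinner H (A x) (A e)"
      unfolding s_def using hadjoint [OF bA A_carrier [OF eH]] by auto
    \<comment> \<open>The residual lies in \<open>N\<close>; first-order minimality at \<open>e\<close> in direction \<open>w\<close> then gives \<open>\<parallel>w\<parallel>\<^sup>2 = 0\<close>.\<close>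
    define w where "w = s \<ominus> of_real \<alpha> \<odot>\<^bsub>H\<^esub> e"
    have wH: "w \<in> carrier H" using sH eH by (simp add: w_def)
    have "cinner H w g = 0" if g: "g \<in> low_eigenvectors H A \<theta>" for g
    proof -
      have gH: "g \<in> carrier H" using g by (simp add: low_eigenvectors_def)
      obtain \<beta> where \<beta>: "\<And>x. x \<in> carrier H \<Longrightarrow> cinner H (A x) (A g) = of_real \<beta> * cinner H x g"
        using g by (auto simp: low_eigenvectors_def)
      have eg: "cinner H e g = 0" using e(1) g by (simp add: N_def)
      \<comment> \<open>Symmetry moves A*A from \<open>e\<close> to \<open>g\<close>, where it acts
        as the real scalar \<beta>, and \<open>e\<close> is orthogonal to \<open>g\<close>.\<close>
      have "cinner H s g = cnj (cinner H (A g) (A e))"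
        using cinner_commute [OF sH gH] cinner_s [OF gH] by simp
      also have "\<dots> = cinner H (A e) (A g)"
        using cinner_commute [OF A_carrier [OF eH] A_carrier [OF gH]] by simp
      finally show ?thesis
        using \<beta> [OF eH] eg sH eH gH by (simp add: w_def cinner_minus_left cinner_smult_left)
    qed
    then have w: "w \<in> N" using wH by (simp add: N_def)
    \<comment> \<open>This polynomial is ||A(e + t w)||^2 - \<alpha> ||e + t w||^2; its constant
      term cancels because \<open>e\<close> is a unit vector.\<close>
    have "0 \<le> 2 * t * (Re (cinner H (A e) (A w)) - \<alpha> * Re (cinner H e w)) +
        t\<^sup>2 * ((hnorm H (A w))\<^sup>2 - \<alpha> * (hnorm H w)\<^sup>2)" for t
    proof -
      have "e \<oplus> of_real t \<odot>\<^bsub>H\<^esub> w \<in> N"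
        using sub e(1) w by (auto simp: VectorSpace.subspace_def submodule_def)
      from min [OF this] show ?thesis
        using eH wH A_carrier
        by (simp add: bounded_operators_add [OF bA] bounded_operators_smult [OF bA]
            hnorm_add_smult_sq e(2) flip: \<alpha>_def) (simp add: algebra_simps)
    qed
    then have "Re (cinner H (A e) (A w)) - \<alpha> * Re (cinner H e w) = 0"
      by (rule linear_term_eq_0)
    moreover have "Re (cinner H (A e) (A w)) - \<alpha> * Re (cinner H e w) = Re (cinner H w w)"
    proof -
      have "Re (cinner H (A e) (A w)) = Re (cinner H w s)"
        using cinner_s [OF wH] cinner_commute [OF A_carrier [OF eH] A_carrier [OF wH]] by simp
      moreover have "Re (cinner H e w) = Re (cinner H w e)"
        using cinner_commute [OF eH wH] by simp
      moreover have "cinner H w w = cinner H w s - of_real \<alpha> * cinner H w e"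
        using wH sH eH by (subst (2) w_def) (simp add: cinner_minus_right cinner_smult_right)
      ultimately show ?thesis by simp
    qed
    ultimately have "w = \<zero>"
      using hnorm_eq_0_iff [OF wH] by (simp add: hnorm_def)
    then have s_eq: "s = of_real \<alpha> \<odot>\<^bsub>H\<^esub> e"
      using sH eH by (simp add: w_def)
    have eigen: "cinner H (A x) (A e) = of_real \<alpha> * cinner H x e" if "x \<in> carrier H" for x
      using cinner_s [OF that] that eH by (simp add: s_eq cinner_smult_right)
    have "\<theta> < \<alpha>"
    proof (rule ccontr)
      assume "\<not> \<theta> < \<alpha>"
      then have "e \<in> low_eigenvectors H A \<theta>"
        using eigen eH by (auto simp: low_eigenvectors_def intro!: exI [of _ \<alpha>])
      then have "cinner H e e = 0" using e(1) by (simp add: N_def)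
      then show False using e(2) by (simp add: hnorm_def)
    qed
    then show thesis
      using min by (intro that [of "\<alpha> - \<theta>"]) (auto simp: N_def)
  qed
qed

text \<open>The projection p of \<open>g\<close> to \<open>M\<close> satisfies ||T p||^2 = \<alpha>
  ||p||^2 because T*T maps \<open>M\<close> into itself; as \<alpha> is at most \<theta>,
  \<open>strict\<close> forces p = 0.\<close>

lemma (in complex_hilbert_space) reducing_orthogonal:
  assumes T: "T \<in> bounded_operators H H" and red: "reduces H M T"
    and strict: "\<And>x. x \<in> M \<Longrightarrow> x \<noteq> \<zero> \<Longrightarrow> \<theta> * (hnorm H x)\<^sup>2 < (hnorm H (T x))\<^sup>2"
    and g: "g \<in> low_eigenvectors H T \<theta>" and x: "x \<in> M"
  shows "cinner H x g = 0"
proof -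
  have closed: "closed_subspace M H" and T_M: "\<And>x. x \<in> M \<Longrightarrow> T x \<in> M"
    and adj_M: "\<And>x. x \<in> M \<Longrightarrow> hadjoint H T x \<in> M"
    using red by (auto simp: reduces_def)
  then have M: "M \<subseteq> carrier H"
    by (auto simp: closed_subspace_def VectorSpace.subspace_def submodule_def)
  interpret M: complex_hilbert_space "H\<lparr>carrier := M\<rparr>"
    using closed by (rule complex_hilbert_closed_subspace)
  obtain \<alpha> where gH: "g \<in> carrier H" and \<alpha>: "\<alpha> \<le> \<theta>"
    and eigen: "\<And>x. x \<in> carrier H \<Longrightarrow> cinner H (T x) (T g) = of_real \<alpha> * cinner H x g"
    using g by (auto simp: low_eigenvectors_def)
  have bound: "cmod (cinner H x g) \<le> hnorm H g * hnorm H x" if "x \<in> carrier H" for x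
    using norm_cinner_le [OF that gH] by (simp add: mult.commute)
  \<comment> \<open>the orthogonal projection of \<open>g\<close> to \<open>M\<close>\<close>
  obtain p where p: "p \<in> M" "\<And>x. x \<in> M \<Longrightarrow> cinner H x g = cinner H x p"
    by (rule M.riesz_representation [where f = "\<lambda>x. cinner H x g" and C = "hnorm H g"])
      (use M gH bound in \<open>auto simp: subset_iff cinner_add_left cinner_smult_left\<close>)
  have pH: "p \<in> carrier H" using p M by auto
  have TpH: "T p \<in> carrier H" using bounded_operators_in_carrier [OF T pH] .
  \<comment> \<open>\<open>q\<close> is T*T p. Both invariance conditions of a reducing subspace
    enter here, to keep \<open>q\<close> in \<open>M\<close>.\<close>
  define q where "q = hadjoint H T (T p)"
  have q: "q \<in> M" using p(1) T_M adj_M by (simp add: q_def)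
  then have qH: "q \<in> carrier H" using M by auto
  have cinner_q: "cinner H y q = cinner H (T y) (T p)" if "y \<in> carrier H" for y
    using cinner_hadjoint [OF T TpH that] by (simp add: q_def)
  \<comment> \<open>Since \<open>q\<close> lies in \<open>M\<close>, \<open>p\<close> may be
    replaced by \<open>g\<close> in the pairing with \<open>q\<close>; the eigenvalue equation for
    \<open>g\<close> then applies.\<close>
  have "cinner H (T p) (T p) = cnj (cinner H q p)"
    using cinner_q [OF pH] cinner_commute [OF pH qH] by simp
  also have "\<dots> = cnj (cinner H q g)" using p(2) [OF q] by simp
  also have "\<dots> = cinner H (T g) (T p)"
    using cinner_q [OF gH] cinner_commute [OF gH qH] by simp
  also have "\<dots> = cnj (of_real \<alpha> * cinner H p g)"
    using eigen [OF pH] cinner_commute [OF bounded_operators_in_carrier [OF T gH] TpH] by simp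
  also have "\<dots> = of_real \<alpha> * of_real ((hnorm H p)\<^sup>2)"
    using p(2) [OF p(1)] cinner_self [OF pH] by simp
  finally have "(hnorm H (T p))\<^sup>2 = \<alpha> * (hnorm H p)\<^sup>2"
    using hnorm_sq [OF TpH] by (simp flip: of_real_mult)
  also have "\<dots> \<le> \<theta> * (hnorm H p)\<^sup>2" using \<alpha> by (simp add: mult_right_mono)
  finally have "p = \<zero>" using strict [OF p(1)] by fastforce
  then show ?thesis using p(2) [OF x] x M by auto
qed

text \<open>Pairing with a tuple supported at \<open>j\<close> sees only coordinate
  \<open>j\<close>. Orthogonality to eigenvectors in the sum thus descends to each summand.\<close>

lemma low_eigenvectors_sum:
  fixes H :: "'i \<Rightarrow> ('a, 'r) inner_product_space_scheme"
  assumes I: "finite I" and H: "\<And>j. j \<in> I \<Longrightarrow> pre_hilbert_space (H j)"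
    and A: "\<And>j. j \<in> I \<Longrightarrow> A j \<in> bounded_operators (H j) (H j)"
    and j: "j \<in> I" and g: "g \<in> low_eigenvectors (H j) (A j) \<theta>"
  defines "g' \<equiv> \<lambda>i\<in>I. if i = j then g else \<zero>\<^bsub>H i\<^esub>"
  shows "g' \<in> low_eigenvectors (hilbert_sum I H) (operator_sum I A) \<theta>"
    and "x \<in> carrier (hilbert_sum I H) \<Longrightarrow> cinner (hilbert_sum I H) x g' = cinner (H j) (x j) g"
proof -
  let ?S = "hilbert_sum I H" and ?T = "operator_sum I A"
  obtain \<alpha> where gH: "g \<in> carrier (H j)" and \<alpha>: "\<alpha> \<le> \<theta>"
    and eigen: "\<And>x. x \<in> carrier (H j) \<Longrightarrow> cinner (H j) (A j x) (A j g) = of_real \<alpha> * cinner (H j) x g"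
    using g by (auto simp: low_eigenvectors_def)
  have zero: "\<zero>\<^bsub>H i\<^esub> \<in> carrier (H i)" "x \<in> carrier (H i) \<Longrightarrow> cinner (H i) x \<zero>\<^bsub>H i\<^esub> = 0"
    "A i \<zero>\<^bsub>H i\<^esub> = \<zero>\<^bsub>H i\<^esub>" if i: "i \<in> I" for i x
  proof -
    interpret Hi: pre_hilbert_space "H i" using i by (rule H)
    show z: "\<zero>\<^bsub>H i\<^esub> \<in> carrier (H i)" by simp
    show "x \<in> carrier (H i) \<Longrightarrow> cinner (H i) x \<zero>\<^bsub>H i\<^esub> = 0" by simp
    \<comment> \<open>The operator bound evaluated at the zero vector yields A 0 = 0.\<close>
    have "hnorm (H i) (A i \<zero>\<^bsub>H i\<^esub>) \<le> 0"
      using Hi.bounded_operators_bound [OF A [OF i]] z Hi.hnorm_zero by (metis mult_zero_right)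
    then show "A i \<zero>\<^bsub>H i\<^esub> = \<zero>\<^bsub>H i\<^esub>"
      using Hi.hnorm_pos [OF bounded_operators_in_carrier [OF A [OF i] z]] by force
  qed
  show cinner_g': "cinner ?S x g' = cinner (H j) (x j) g" if "x \<in> carrier ?S" for x
  proof -
    have "cinner ?S x g' = (\<Sum>i\<in>I. if i = j then cinner (H j) (x j) g else 0)"
      unfolding hilbert_sum_simps by (rule sum.cong) (use that zero in \<open>auto simp: g'_def\<close>)
    then show ?thesis using I j by simp
  qed
  have "cinner ?S (?T x) (?T g') = of_real \<alpha> * cinner ?S x g'" if x: "x \<in> carrier ?S" for x
  proof -
    have "cinner ?S (?T x) (?T g') = (\<Sum>i\<in>I. if i = j then cinner (H j) (A j (x j)) (A j g) else 0)"
      unfolding hilbert_sum_simps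
      by (rule sum.cong)
        (use x zero(2) [OF _ bounded_operators_in_carrier [OF A]] in
          \<open>auto simp: g'_def operator_sum_def zero(3)\<close>)
    also have "\<dots> = of_real \<alpha> * cinner ?S x g'"
      using I j x eigen unfolding cinner_g' [OF x] by auto
    finally show ?thesis .
  qed
  moreover have "g' \<in> carrier ?S" using gH zero(1) by (auto simp: g'_def)
  ultimately show "g' \<in> low_eigenvectors ?S ?T \<theta>"
    using \<alpha> unfolding low_eigenvectors_def by blast
qed

section \<open>Combining the gaps of the summands\<close>

theorem operator_sum_min_attaining_on_reducing:
  fixes H :: "'i \<Rightarrow> ('a, 'r) inner_product_space_scheme"
  assumes I: "finite I" and H: "\<And>j. j \<in> I \<Longrightarrow> complex_hilbert_space (H j)"
    and A: "\<And>j. j \<in> I \<Longrightarrow> abs_min_attaining (H j) (A j)"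
  shows "operator_sum I A \<in> \<M>\<^sub>r (hilbert_sum I H)"
proof -
  let ?S = "hilbert_sum I H" and ?T = "operator_sum I A"
  have pre: "pre_hilbert_space (H j)" if "j \<in> I" for j
  proof -
    interpret complex_hilbert_space "H j" using that by (rule H)
    show ?thesis by (rule pre_hilbert_space_axioms)
  qed
  have bA: "A j \<in> bounded_operators (H j) (H j)" if "j \<in> I" for j
    using A [OF that] by (simp add: abs_min_attaining_def)
  interpret S: complex_hilbert_space ?S
    using I H by (rule complex_hilbert_hilbert_sum)
  have bT: "?T \<in> bounded_operators ?S ?S"
    using I pre bA by (rule operator_sum_bounded)
  have "min_attaining (?S\<lparr>carrier := M\<rparr>) (?S\<lparr>carrier := M\<rparr>) ?T"
    if red: "reduces ?S M ?T" and nz: "M \<noteq> {\<zero>\<^bsub>?S\<^esub>}" for M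
  proof (rule ccontr)
    assume not_att: "\<not> min_attaining (?S\<lparr>carrier := M\<rparr>) (?S\<lparr>carrier := M\<rparr>) ?T"
    \<comment> \<open>The codomain is enlarged from \<open>M\<close> to the whole sum, where the
      operator is known to be bounded; \<open>hnorm\<close> ignores the carrier, so the modulus is
      unchanged.\<close>
    define \<mu> where "\<mu> = min_modulus (?S\<lparr>carrier := M\<rparr>) ?S ?T"
    have \<mu>: "min_modulus (?S\<lparr>carrier := M\<rparr>) (?S\<lparr>carrier := M\<rparr>) ?T = \<mu>"
      by (simp add: \<mu>_def min_modulus_def)
    have sub: "VectorSpace.subspace class_ring M ?S"
      using red by (simp add: reduces_def closed_subspace_def)
    then have MS: "M \<subseteq> carrier ?S" and "\<zero>\<^bsub>?S\<^esub> \<in> M"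
      by (auto simp: VectorSpace.subspace_def submodule_def simp del: hilbert_sum_simps)
    \<comment> \<open>A unit vector in \<open>M\<close> makes the set of norms nonempty, as lower
      bounds for its infimum require.\<close>
    with nz obtain v where "v \<in> M" "v \<noteq> \<zero>\<^bsub>?S\<^esub>" by blast
    then obtain u where u: "u \<in> M" "hnorm ?S u = 1"
      using S.scaled_unit_vector [OF sub] by blast
    have T_carrier: "?T x \<in> carrier ?S" if "x \<in> M" for x
      using bounded_operators_in_carrier [OF bT] that MS by blast
    have \<mu>_nonneg: "0 \<le> \<mu>"
      unfolding \<mu>_def min_modulus_def
      by (rule cInf_greatest) (use u T_carrier S.hnorm_nonneg in auto)
    \<comment> \<open>Unit vectors satisfy the bound by \<mu> strictly because the infimum is not
      attained; scaling extends this to all nonzero vectors.\<close>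
    have strict: "\<mu>\<^sup>2 * (hnorm ?S x)\<^sup>2 < (hnorm ?S (?T x))\<^sup>2" if x: "x \<in> M" "x \<noteq> \<zero>\<^bsub>?S\<^esub>" for x
    proof -
      have xS: "x \<in> carrier ?S" using x MS by blast
      obtain e where e: "e \<in> M" "hnorm ?S e = 1" "x = of_real (hnorm ?S x) \<odot>\<^bsub>?S\<^esub> e"
        using S.scaled_unit_vector [OF sub x] .
      have eS: "e \<in> carrier ?S" using e MS by blast
      have "\<mu> \<le> hnorm ?S (?T e)"
        using S.min_modulus_mult_le [OF S.pre_hilbert_space_axioms bT sub e(1)] e(2)
        by (simp add: \<mu>_def)
      moreover have "hnorm ?S (?T e) \<noteq> \<mu>"
        using not_att e \<mu> by (auto simp: min_attaining_def)
      moreover have "?T x = of_real (hnorm ?S x) \<odot>\<^bsub>?S\<^esub> ?T e"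
        using bounded_operators_smult [OF bT eS] e(3) by metis
      then have "hnorm ?S (?T x) = hnorm ?S x * hnorm ?S (?T e)"
        using S.hnorm_smult [OF T_carrier [OF e(1)]] S.hnorm_nonneg [OF xS] by simp
      ultimately have "\<mu> * hnorm ?S x < hnorm ?S (?T x)"
        using S.hnorm_pos [OF xS x(2)] by (simp add: mult.commute)
      then have "(\<mu> * hnorm ?S x)\<^sup>2 < (hnorm ?S (?T x))\<^sup>2"
        using \<mu>_nonneg S.hnorm_nonneg [OF xS] by (intro power_strict_mono) auto
      then show ?thesis by (simp add: power_mult_distrib)
    qed
    have "\<exists>\<epsilon>>0. \<forall>y\<in>carrier (H j). (\<forall>g\<in>low_eigenvectors (H j) (A j) (\<mu>\<^sup>2). cinner (H j) y g = 0) \<longrightarrow>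
        (\<mu>\<^sup>2 + \<epsilon>) * (hnorm (H j) y)\<^sup>2 \<le> (hnorm (H j) (A j y))\<^sup>2" if "j \<in> I" for j
      using complex_hilbert_space.abs_min_attaining_gap [OF H A, OF that that, of "\<mu>\<^sup>2"] by metis
    then obtain \<epsilon> where \<epsilon>_pos: "\<And>j. j \<in> I \<Longrightarrow> 0 < \<epsilon> j"
      and gap: "\<And>j y. j \<in> I \<Longrightarrow> y \<in> carrier (H j) \<Longrightarrow>
        \<forall>g\<in>low_eigenvectors (H j) (A j) (\<mu>\<^sup>2). cinner (H j) y g = 0 \<Longrightarrow>
        (\<mu>\<^sup>2 + \<epsilon> j) * (hnorm (H j) y)\<^sup>2 \<le> (hnorm (H j) (A j y))\<^sup>2"
      by metis
    \<comment> \<open>One gap for all coordinates, positive because \<open>I\<close> is finite; the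
      inserted 1 keeps the set nonempty.\<close>
    define \<delta> where "\<delta> = Min (insert 1 (\<epsilon> ` I))"
    have \<delta>: "0 < \<delta>" "\<And>j. j \<in> I \<Longrightarrow> \<delta> \<le> \<epsilon> j"
      using I \<epsilon>_pos by (auto simp: \<delta>_def)
    have bounded_below: "(\<mu>\<^sup>2 + \<delta>) * (hnorm ?S x)\<^sup>2 \<le> (hnorm ?S (?T x))\<^sup>2" if x: "x \<in> M" for x
    proof -
      have xS: "x \<in> carrier ?S" using x MS by blast
      have "(\<mu>\<^sup>2 + \<delta>) * (hnorm ?S x)\<^sup>2 = (\<Sum>j\<in>I. (\<mu>\<^sup>2 + \<delta>) * (hnorm (H j) (x j))\<^sup>2)"
        using hnorm_hilbert_sum_sq [OF I pre xS] by (simp add: sum_distrib_left)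
      also have "\<dots> \<le> (\<Sum>j\<in>I. (hnorm (H j) (A j (x j)))\<^sup>2)"
      proof (rule sum_mono)
        fix j assume j: "j \<in> I"
        have xj: "x j \<in> carrier (H j)" using xS j by auto
        have "cinner (H j) (x j) g = 0" if g: "g \<in> low_eigenvectors (H j) (A j) (\<mu>\<^sup>2)" for g
        proof -
          let ?g = "\<lambda>i\<in>I. if i = j then g else \<zero>\<^bsub>H i\<^esub>"
          have "?g \<in> low_eigenvectors ?S ?T (\<mu>\<^sup>2)"
            by (rule low_eigenvectors_sum(1) [where H = H and A = A, OF I _ _ j g]) (auto intro: pre bA)
          then have "cinner ?S x ?g = 0"
            using S.reducing_orthogonal [OF bT red strict _ x] by blast
          moreover have "cinner ?S x ?g = cinner (H j) (x j) g"
            by (rule low_eigenvectors_sum(2) [where H = H and A = A, OF I _ _ j g xS]) (auto intro: pre bA)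
          ultimately show ?thesis by simp
        qed
        then have "(\<mu>\<^sup>2 + \<epsilon> j) * (hnorm (H j) (x j))\<^sup>2 \<le> (hnorm (H j) (A j (x j)))\<^sup>2"
          using gap [OF j xj] by blast
        moreover have "(\<mu>\<^sup>2 + \<delta>) * (hnorm (H j) (x j))\<^sup>2 \<le> (\<mu>\<^sup>2 + \<epsilon> j) * (hnorm (H j) (x j))\<^sup>2"
          using \<delta>(2) [OF j] by (intro mult_right_mono) auto
        ultimately show "(\<mu>\<^sup>2 + \<delta>) * (hnorm (H j) (x j))\<^sup>2 \<le> (hnorm (H j) (A j (x j)))\<^sup>2"
          by linarith
      qed
      also have "\<dots> = (hnorm ?S (?T x))\<^sup>2"
        using hnorm_hilbert_sum_sq [OF I pre T_carrier [OF x]] by (simp add: operator_sum_def)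
      finally show ?thesis .
    qed
    \<comment> \<open>On unit vectors the uniform gap gives a lower bound larger than the infimum
      \<mu>, which is absurd.\<close>
    have "sqrt (\<mu>\<^sup>2 + \<delta>) \<le> hnorm ?S (?T x)" if "x \<in> M" "hnorm ?S x = 1" for x
      using bounded_below [OF that(1)] that S.hnorm_nonneg [OF T_carrier [OF that(1)]]
      by (intro real_le_lsqrt) auto
    then have "sqrt (\<mu>\<^sup>2 + \<delta>) \<le> min_modulus (?S\<lparr>carrier := M\<rparr>) ?S ?T"
      unfolding min_modulus_def by (intro cInf_greatest) (use u in auto)
    then have "sqrt (\<mu>\<^sup>2 + \<delta>) \<le> \<mu>" by (simp only: \<mu>_def)
    then have "\<mu>\<^sup>2 + \<delta> \<le> \<mu>\<^sup>2"
      by (rule sqrt_le_D)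
    with \<delta>(1) show False by simp
  qed
  then show ?thesis
    using bT by (auto simp: min_attaining_on_reducing_def simp del: hilbert_sum_simps)
qed

theorem corollary5p5:
  fixes n :: nat
    and H :: "nat \<Rightarrow> 'a inner_product_space"
    and A :: "nat \<Rightarrow> 'a \<Rightarrow> 'a"
  assumes "n \<ge> 1"
    and "\<And>j. j \<in> {1..n} \<Longrightarrow> separable_hilbert_space (H j)"
    and "\<And>j. j \<in> {1..n} \<Longrightarrow> infinite_dimensional (H j)"
    and "\<And>j. j \<in> {1..n} \<Longrightarrow> abs_min_attaining (H j) (A j)"
  shows "operator_sum {1..n} A \<in> \<M>\<^sub>r (hilbert_sum {1..n} H)"
  using assms by (intro operator_sum_min_attaining_on_reducing)
    (auto simp: separable_hilbert_space_def)

end
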